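(* Let $p\ge 1$. If $p\le 3$, the ideal $I_{p,1}$ is the zero ideal. If $p\ge 4$, the set of tetrads $$\mathcal{T}_p=\{\underline{\psi_{ij}\psi_{k\ell}}-\psi_{ik}\psi_{j\ell},\ \underline{\psi_{i\ell}\psi_{jk}}-\psi_{ik}\psi_{j\ell} \;:\; 1\le i<j<k<\ell\le p\}$$ is the reduced Gröbner basis of the ideal $I_{p,1}$ with respect to the monomial order $\succ$.
   Context: $\mathbb{R}[\psi_{ij},\, i<j]$ is the polynomial ring in the $\binom{p}{2}$ indeterminates $\psi_{ij}$, $1\le i<j\le p$, regarded as the off-diagonal entries of a symmetric $p\times p$-matrix $\Psi$. $F_{p,1}=\{\Sigma+\lambda\lambda^t\in\mathbb{R}^{p\times p} : \Sigma \text{ diagonal and positive definite},\ \lambda\in\mathbb{R}^{p}\}$ is the parameter space of the one-factor analysis model, and $I_{p,1}$ is the ideal of all $f\in\mathbb{R}[\psi_{ij},\, i<j]$ with $f(\Psi)=0$ for all $\Psi\in F_{p,1}$. $\succ$ is a monomial order on $\mathbb{R}[\psi_{ij},\, i<j]$ for which the underlined terms $\psi_{ij}\psi_{k\ell}$ and $\psi_{i\ell}\psi_{jk}$ are the leading terms of the tetrads in $\mathcal{T}_p$, for all $1\le i<j<k<\ell\le p$. Such an order exists. One example (the "thrackle order") is any monomial order refining the weight in which $\psi_{ij}$ has weight equal to the number of edges of the complete graph $K_p$, drawn with straight edges on $p$ points placed in cyclic order $1,\dots,p$ in convex position, that are disjoint (as closed segments) from the edge $\{i,j\}$. *)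

theory Defs
  imports
    "HOL-Library.Poly_Mapping"
    "HOL-Library.Nat_Bijection"
    "HOL-Algebra.Ideal"
    "Jordan_Normal_Form.Matrix"
begin

text \<open>
  A monomial is a finitely supported exponent vector, written additively; a real polynomial is a
  finitely supported map from monomials to coefficients, with the convolution product.
  Matrix indices follow \<^typ>\<open>real mat\<close> and run over \<open>0,\<dots>,p-1\<close> instead of \<open>1,\<dots>,p\<close>.
\<close>

type_synonym 'x monomial = "'x \<Rightarrow>\<^sub>0 nat"
type_synonym 'x mpolynomial = "'x monomial \<Rightarrow>\<^sub>0 real"

definition monomials :: "'x set \<Rightarrow> 'x monomial set" where
  "monomials V = {m. Poly_Mapping.keys m \<subseteq> V}"

definition poly_ring :: "'x set \<Rightarrow> 'x mpolynomial ring" where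
  "poly_ring V = \<lparr>carrier = {f. Poly_Mapping.keys f \<subseteq> monomials V},
     monoid.mult = (*), one = 1, zero = 0, add = (+)\<rparr>"

definition poly_eval :: "('x \<Rightarrow> real) \<Rightarrow> 'x mpolynomial \<Rightarrow> real" where
  "poly_eval a f = (\<Sum>m\<in>Poly_Mapping.keys f. Poly_Mapping.lookup f m *
     (\<Prod>x\<in>Poly_Mapping.keys m. a x ^ Poly_Mapping.lookup m x))"

text \<open>A monomial order is given by its reflexive form: \<open>(a, b) \<in> r\<close> means that \<open>b\<close> is at least
  as large as \<open>a\<close>. The monomial \<open>1\<close> is the exponent vector \<open>0\<close>. For a finite set of variables such
  an order is automatically a well-order.\<close>

definition monomial_order :: "'x set \<Rightarrow> 'x monomial rel \<Rightarrow> bool" where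
  "monomial_order V r \<longleftrightarrow>
     linear_order_on (monomials V) r \<and>
     (\<forall>a\<in>monomials V. (0, a) \<in> r) \<and>
     (\<forall>a\<in>monomials V. \<forall>b\<in>monomials V. \<forall>c\<in>monomials V. (a, b) \<in> r \<longrightarrow> (a + c, b + c) \<in> r)"

text \<open>The leading monomial, coefficient and term are meaningful for nonzero polynomials only.\<close>

definition lead_monomial :: "'x monomial rel \<Rightarrow> 'x mpolynomial \<Rightarrow> 'x monomial" where
  "lead_monomial r f =
     (THE m. m \<in> Poly_Mapping.keys f \<and> (\<forall>m'\<in>Poly_Mapping.keys f. (m', m) \<in> r))"

definition leading_coefficient :: "'x monomial rel \<Rightarrow> 'x mpolynomial \<Rightarrow> real" where
  "leading_coefficient r f = Poly_Mapping.lookup f (lead_monomial r f)"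

definition lead_term :: "'x monomial rel \<Rightarrow> 'x mpolynomial \<Rightarrow> 'x mpolynomial" where
  "lead_term r f = Poly_Mapping.single (lead_monomial r f) (leading_coefficient r f)"

definition initial_ideal ::
  "'x set \<Rightarrow> 'x monomial rel \<Rightarrow> 'x mpolynomial set \<Rightarrow> 'x mpolynomial set" where
  "initial_ideal V r I = Idl\<^bsub>poly_ring V\<^esub> (lead_term r ` (I - {0}))"

definition groebner_basis ::
  "'x set \<Rightarrow> 'x monomial rel \<Rightarrow> 'x mpolynomial set \<Rightarrow> 'x mpolynomial set \<Rightarrow> bool" where
  "groebner_basis V r I G \<longleftrightarrow>
     finite G \<and> G \<subseteq> I \<and> 0 \<notin> G \<and>
     Idl\<^bsub>poly_ring V\<^esub> (lead_term r ` G) = initial_ideal V r I"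

definition monomial_divides :: "'x monomial \<Rightarrow> 'x monomial \<Rightarrow> bool" where
  "monomial_divides a b \<longleftrightarrow> (\<exists>c. b = a + c)"

definition reduced_groebner_basis ::
  "'x set \<Rightarrow> 'x monomial rel \<Rightarrow> 'x mpolynomial set \<Rightarrow> 'x mpolynomial set \<Rightarrow> bool" where
  "reduced_groebner_basis V r I G \<longleftrightarrow>
     groebner_basis V r I G \<and>
     (\<forall>g\<in>G. leading_coefficient r g = 1) \<and>
     (\<forall>g\<in>G. \<forall>h\<in>G. g \<noteq> h \<longrightarrow>
        (\<forall>m\<in>Poly_Mapping.keys h. \<not> monomial_divides (lead_monomial r g) m))"

definition positive_definite :: "real mat \<Rightarrow> bool" where
  "positive_definite A \<longleftrightarrow>
     square_mat A \<and> transpose_mat A = A \<and>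
     (\<forall>v\<in>carrier_vec (dim_row A). v \<noteq> 0\<^sub>v (dim_row A) \<longrightarrow> v \<bullet> (A *\<^sub>v v) > 0)"

definition one_factor_space :: "nat \<Rightarrow> real mat set" where
  "one_factor_space p =
     {\<Sigma> + mat_of_cols p [l] * transpose_mat (mat_of_cols p [l]) | \<Sigma> l.
        \<Sigma> \<in> carrier_mat p p \<and> diagonal_mat \<Sigma> \<and> positive_definite \<Sigma> \<and> l \<in> carrier_vec p}"

definition psi_vars :: "nat \<Rightarrow> (nat \<times> nat) set" where
  "psi_vars p = {(i, j). i < j \<and> j < p}"

definition psi :: "nat \<Rightarrow> nat \<Rightarrow> (nat \<times> nat) mpolynomial" where
  "psi i j = Poly_Mapping.single (Poly_Mapping.single (i, j) 1) 1"

definition one_factor_ideal :: "nat \<Rightarrow> (nat \<times> nat) mpolynomial set" where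
  "one_factor_ideal p =
     {f \<in> carrier (poly_ring (psi_vars p)).
        \<forall>\<Psi>\<in>one_factor_space p. poly_eval (\<lambda>(i, j). \<Psi> $$ (i, j)) f = 0}"

definition tetrad1 :: "nat \<Rightarrow> nat \<Rightarrow> nat \<Rightarrow> nat \<Rightarrow> (nat \<times> nat) mpolynomial" where
  "tetrad1 i j k l = psi i j * psi k l - psi i k * psi j l"

definition tetrad2 :: "nat \<Rightarrow> nat \<Rightarrow> nat \<Rightarrow> nat \<Rightarrow> (nat \<times> nat) mpolynomial" where
  "tetrad2 i j k l = psi i l * psi j k - psi i k * psi j l"

definition tetrads :: "nat \<Rightarrow> (nat \<times> nat) mpolynomial set" where
  "tetrads p =
     {t. \<exists>i j k l. i < j \<and> j < k \<and> k < l \<and> l < p \<and> (t = tetrad1 i j k l \<or> t = tetrad2 i j k l)}"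

definition selects_underlined_terms :: "nat \<Rightarrow> (nat \<times> nat) monomial rel \<Rightarrow> bool" where
  "selects_underlined_terms p r \<longleftrightarrow>
     (\<forall>i j k l. i < j \<and> j < k \<and> k < l \<and> l < p \<longrightarrow>
        lead_term r (tetrad1 i j k l) = psi i j * psi k l \<and>
        lead_term r (tetrad2 i j k l) = psi i l * psi j k)"

lemma poly_ring_cring: "cring (poly_ring V)"
proof -
  have plus: "a + b \<in> monomials V" if "a \<in> monomials V" "b \<in> monomials V" for a b :: "'a monomial"
    using that Poly_Mapping.keys_add[of a b] by (auto simp: monomials_def)
  have add: "Poly_Mapping.keys (f + g) \<subseteq> monomials V"
    if "Poly_Mapping.keys f \<subseteq> monomials V" "Poly_Mapping.keys g \<subseteq> monomials V"
    for f g :: "'a mpolynomial"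
    using that Poly_Mapping.keys_add[of f g] by blast
  have mult: "Poly_Mapping.keys (f * g) \<subseteq> monomials V"
    if "Poly_Mapping.keys f \<subseteq> monomials V" "Poly_Mapping.keys g \<subseteq> monomials V"
    for f g :: "'a mpolynomial"
    using that Poly_Mapping.keys_mult[of f g] plus by blast
  show ?thesis
  proof (rule cringI)
    show "abelian_group (poly_ring V)"
    proof (rule abelian_groupI)
      fix f assume "f \<in> carrier (poly_ring V)"
      then have "- f \<in> carrier (poly_ring V)" by (simp add: poly_ring_def)
      moreover have "- f \<oplus>\<^bsub>poly_ring V\<^esub> f = \<zero>\<^bsub>poly_ring V\<^esub>" by (simp add: poly_ring_def)
      ultimately show "\<exists>g\<in>carrier (poly_ring V). g \<oplus>\<^bsub>poly_ring V\<^esub> f = \<zero>\<^bsub>poly_ring V\<^esub>" by blast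
    qed (auto simp: poly_ring_def ac_simps dest: add[THEN subsetD, rotated 2])
    show "comm_monoid (poly_ring V)"
      by (rule comm_monoidI)
        (auto simp: poly_ring_def ac_simps monomials_def[of V]
          dest: mult[THEN subsetD, rotated 2, unfolded monomials_def])
  qed (simp add: poly_ring_def distrib_right)
qed

text \<open>Orders selecting the underlined terms exist: weight \<open>\<psi>\<^sub>i\<^sub>j\<close> by \<open>p\<^sup>2 - d (p - d)\<close>
  with \<open>d = j - i\<close>, and break ties lexicographically.\<close>

lemma selecting_order_exists: "\<exists>r. monomial_order (psi_vars p) r \<and> selects_underlined_terms p r"
proof -
  define c :: "nat \<times> nat \<Rightarrow> int"
    where "c = (\<lambda>(i, j). (int p)\<^sup>2 + (int j - int i)\<^sup>2 - int p * (int j - int i))"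
  define w :: "(nat \<times> nat) monomial \<Rightarrow> int"
    where "w m = (\<Sum>v\<in>psi_vars p. int (Poly_Mapping.lookup m v) * c v)" for m
  define e :: "(nat \<times> nat) monomial \<Rightarrow> nat monomial"
    where "e m = Poly_Mapping.map_key prod_decode m" for m
  define r where "r = {(a, b). a \<in> monomials (psi_vars p) \<and> b \<in> monomials (psi_vars p) \<and>
      (w a < w b \<or> w a = w b \<and> e a \<le> e b)}"
  have fin: "finite (psi_vars p)"
    by (rule finite_subset[of _ "{..<p} \<times> {..<p}"]) (auto simp: psi_vars_def)
  have inj: "inj prod_decode" by (simp add: inj_prod_decode)
  have e_lookup: "Poly_Mapping.lookup (e m) n = Poly_Mapping.lookup m (prod_decode n)" for m n
    by (simp add: e_def map_key.rep_eq[OF inj])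
  have e_add: "e (a + b) = e a + e b" for a b
    by (rule poly_mapping_eqI) (simp add: e_lookup lookup_add)
  have e_inj: "a = b" if "e a = e b" for a b
  proof (rule poly_mapping_eqI)
    fix v
    have "Poly_Mapping.lookup (e a) (prod_encode v) = Poly_Mapping.lookup (e b) (prod_encode v)"
      using that by simp
    then show "Poly_Mapping.lookup a v = Poly_Mapping.lookup b v" by (simp add: e_lookup)
  qed
  have e0: "0 \<le> e a" for a
  proof -
    have "0 \<le> m" for m :: "nat monomial"
    proof (rule ccontr)
      assume "\<not> 0 \<le> m"
      then have "m < 0" by simp
      then show False by transfer (auto simp: less_fun_def)
    qed
    then show ?thesis .
  qed
  have e_0: "e 0 = 0" by (rule poly_mapping_eqI) (simp add: e_lookup)
  have w_add: "w (a + b) = w a + w b" for a b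
    by (simp add: w_def lookup_add algebra_simps sum.distrib)
  have c_pos: "0 \<le> c v" if "v \<in> psi_vars p" for v
  proof -
    obtain i j where v: "v = (i, j)" "i < j" "j < p" using \<open>v \<in> psi_vars p\<close> by (auto simp: psi_vars_def)
    have "0 \<le> int p * (int p - (int j - int i))"
      using v by (intro mult_nonneg_nonneg) auto
    then show ?thesis
      using zero_le_power2[of "int j - int i"] by (simp add: v c_def power2_eq_square algebra_simps)
  qed
  have w_pos: "0 \<le> w m" for m
    unfolding w_def by (intro sum_nonneg mult_nonneg_nonneg c_pos) auto
  have w_0: "w 0 = 0" by (simp add: w_def)
  have mo: "monomial_order (psi_vars p) r"
    unfolding monomial_order_def
  proof (intro conjI ballI impI)
    show "linear_order_on (monomials (psi_vars p)) r"
      unfolding order_on_defs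
      by (auto simp: r_def refl_on_def trans_def antisym_def total_on_def dest: e_inj)
    show "(0, a) \<in> r" if "a \<in> monomials (psi_vars p)" for a
      using that w_pos[of a] e0[of a] by (auto simp: r_def monomials_def w_0 e_0)
    show "(a + d, b + d) \<in> r"
      if "a \<in> monomials (psi_vars p)" "b \<in> monomials (psi_vars p)"
        "d \<in> monomials (psi_vars p)" "(a, b) \<in> r" for a b d
    proof -
      have "a + d \<in> monomials (psi_vars p)" "b + d \<in> monomials (psi_vars p)"
        using that Poly_Mapping.keys_add[of a d] Poly_Mapping.keys_add[of b d]
        unfolding monomials_def by blast+
      then show ?thesis using that(4) by (auto simp: r_def w_add e_add)
    qed
  qed
  have w_single: "w (Poly_Mapping.single v 1) = c v" if "v \<in> psi_vars p" for v
  proof -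
    have "w (Poly_Mapping.single v 1) = (\<Sum>u\<in>psi_vars p. if u = v then c u else 0)"
      unfolding w_def by (rule sum.cong) (auto simp: lookup_single when_def)
    then show ?thesis using that fin by simp
  qed
  have lead: "lead_term r (Poly_Mapping.single a 1 - Poly_Mapping.single b 1) = Poly_Mapping.single a 1"
    if "a \<in> monomials (psi_vars p)" "b \<in> monomials (psi_vars p)" "w b < w a" for a b
  proof -
    let ?f = "Poly_Mapping.single a 1 - Poly_Mapping.single b 1 :: (nat \<times> nat) mpolynomial"
    have "a \<noteq> b" using that by auto
    then have keys: "Poly_Mapping.keys ?f = {a, b}"
      by (auto simp: in_keys_iff lookup_minus lookup_single when_def split: if_splits)
    have "lead_monomial r ?f = a"
      unfolding lead_monomial_def keys using that by (intro the_equality) (auto simp: r_def)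
    then show ?thesis
      using \<open>a \<noteq> b\<close>
      by (simp add: lead_term_def leading_coefficient_def lookup_minus lookup_single)
  qed
  have psi2: "psi i j * psi k l =
      Poly_Mapping.single (Poly_Mapping.single (i, j) 1 + Poly_Mapping.single (k, l) 1) 1" for i j k l
    by (simp add: psi_def mult_single)
  have mon: "Poly_Mapping.single u 1 + Poly_Mapping.single v 1 \<in> monomials (psi_vars p)"
    if "u \<in> psi_vars p" "v \<in> psi_vars p" for u v
    using that Poly_Mapping.keys_add[of "Poly_Mapping.single u (1::nat)" "Poly_Mapping.single v 1"]
    by (auto simp: monomials_def)
  have "selects_underlined_terms p r"
    unfolding selects_underlined_terms_def
  proof (intro allI impI)
    fix i j k l assume ijkl: "i < j \<and> j < k \<and> k < l \<and> l < p"
    have vars: "(i, j) \<in> psi_vars p" "(k, l) \<in> psi_vars p" "(i, k) \<in> psi_vars p"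
      "(j, l) \<in> psi_vars p" "(i, l) \<in> psi_vars p" "(j, k) \<in> psi_vars p"
      using ijkl by (auto simp: psi_vars_def)
    have "0 < (int k - int j) * (int p - (int l - int i))"
      using ijkl by (intro mult_pos_pos) auto
    then have 1: "c (i, k) + c (j, l) < c (i, j) + c (k, l)"
      by (simp add: c_def power2_eq_square algebra_simps)
    have "0 < (int j - int i) * (int l - int k)"
      using ijkl by (intro mult_pos_pos) auto
    then have 2: "c (i, k) + c (j, l) < c (i, l) + c (j, k)"
      by (simp add: c_def power2_eq_square algebra_simps)
    show "lead_term r (tetrad1 i j k l) = psi i j * psi k l \<and>
        lead_term r (tetrad2 i j k l) = psi i l * psi j k"
      unfolding tetrad1_def tetrad2_def psi2
      using 1 2 by (intro conjI lead mon vars) (simp_all only: w_add w_single vars)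
  qed
  then show ?thesis using mo by blast
qed

end

theory Submission
  imports Defs "HOL-Computational_Algebra.Polynomial"
begin

text \<open>
  A monomial is the edge multiset of a multigraph on \<open>0,\<dots>,p-1\<close>. Off the diagonal a matrix of the
  model has the entries \<open>x\<^sub>i x\<^sub>j\<close> with \<open>x\<close> arbitrary, so a polynomial lies in the ideal if and only if
  its coefficients sum to zero over the monomials with any prescribed vertex degrees. The monomials
  not divisible by an underlined term are the thrackles, whose edges pairwise cross or share a
  vertex when the vertices are placed on a circle. A thrackle is determined by its vertex degrees,
  and it is the smallest monomial with these degrees; hence it is not a leading monomial of the
  ideal. For \<open>p \<le> 3\<close> every monomial is a thrackle.
\<close>

section \<open>Vertex degrees and thrackles\<close>

text \<open>The exponent of x_v after the substitution psi_ij = x_i x_j, that is, the multidegree by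
  which the ideal sorts monomials into fibers.\<close>

definition vertex_degree :: "nat \<Rightarrow> (nat \<times> nat) monomial \<Rightarrow> nat \<Rightarrow> nat" where
  "vertex_degree p m v =
     (\<Sum>e\<in>psi_vars p. Poly_Mapping.lookup m e * (of_bool (fst e = v) + of_bool (snd e = v)))"

text \<open>The two forbidden configurations, one edge wholly to the left of the other and one edge
  strictly nested in the other, are the edge pairs of the underlined terms. As ordered pairs are
  quantified, each condition is also tested with the edges exchanged.\<close>

definition thrackle :: "(nat \<times> nat) monomial \<Rightarrow> bool" where
  "thrackle m \<longleftrightarrow>
     (\<forall>a b c d. (a, b) \<in> Poly_Mapping.keys m \<longrightarrow> (c, d) \<in> Poly_Mapping.keys m \<longrightarrow>
        c \<le> b \<and> \<not> (a < c \<and> d < b))"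

lemma finite_psi_vars [simp]: "finite (psi_vars p)"
  by (rule finite_subset[of _ "{..<p} \<times> {..<p}"]) (auto simp: psi_vars_def)

lemma vertex_degree_add:
  "vertex_degree p (a + b) v = vertex_degree p a v + vertex_degree p b v"
  by (simp add: vertex_degree_def lookup_add distrib_right sum.distrib)

lemma vertex_degree_single:
  "(i, j) \<in> psi_vars p \<Longrightarrow>
    vertex_degree p (Poly_Mapping.single (i, j) 1) v = of_bool (i = v) + of_bool (j = v)"
  by (simp add: vertex_degree_def lookup_single when_def if_distrib[of "\<lambda>x. x * _"]
      if_distribR sum.delta cong: if_cong)

lemma vertex_degree_eq_0: "p \<le> v \<Longrightarrow> vertex_degree p m v = 0"
  unfolding vertex_degree_def by (rule sum.neutral) (auto simp: psi_vars_def)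

text \<open>Double counting: an edge contributes once for each of its endpoints below
  \<open>i\<close>.\<close>

lemma sum_vertex_degree_lessThan:
  "(\<Sum>v<i. vertex_degree p m v) =
    sum (Poly_Mapping.lookup m) {e\<in>psi_vars p. fst e < i} +
    sum (Poly_Mapping.lookup m) {e\<in>psi_vars p. snd e < i}"
proof -
  have "(\<Sum>v<i. vertex_degree p m v) =
    (\<Sum>e\<in>psi_vars p. \<Sum>v<i. Poly_Mapping.lookup m e * (of_bool (fst e = v) + of_bool (snd e = v)))"
    unfolding vertex_degree_def by (rule sum.swap)
  also have "\<dots> = (\<Sum>e\<in>psi_vars p. (if fst e < i then Poly_Mapping.lookup m e else 0) +
      (if snd e < i then Poly_Mapping.lookup m e else 0))"
    by (intro sum.cong)
       (auto simp: distrib_left sum.distrib of_bool_def if_distrib[of "\<lambda>x. _ * x"] sum.delta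
        simp flip: sum_distrib_left cong: if_cong)
  finally show ?thesis
    by (simp add: sum.distrib sum.inter_filter)
qed

text \<open>Componentwise, the edges of a thrackle form a chain, and no first endpoint exceeds a second
  one. Hence listing the first endpoints and then the second endpoints in increasing order sorts
  all endpoints, so that the counts below are functions of the vertex degrees.\<close>

lemma thrackle_rectangle_sum:
  assumes m: "m \<in> monomials (psi_vars p)" and t: "thrackle m"
  defines "N \<equiv> (\<Sum>v<p. vertex_degree p m v) div 2"
  shows "(\<Sum>a<i. \<Sum>b<j. Poly_Mapping.lookup m (a, b)) =
    min (min (\<Sum>v<i. vertex_degree p m v) N) ((\<Sum>v<j. vertex_degree p m v) - N)"
proof -
  define cnt where "cnt P = sum (Poly_Mapping.lookup m) {e\<in>psi_vars p. P e}" for P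
  have keys: "Poly_Mapping.lookup m e = 0" if "e \<notin> psi_vars p" for e
    using m that by (auto simp: monomials_def in_keys_iff)
  have th: "c \<le> b" "a < c \<Longrightarrow> \<not> d < b"
    if "Poly_Mapping.lookup m (a, b) \<noteq> 0" "Poly_Mapping.lookup m (c, d) \<noteq> 0" for a b c d
    using t that unfolding thrackle_def in_keys_iff by blast+
  have cnt_mono: "cnt P \<le> cnt Q" if "\<And>e. P e \<Longrightarrow> Q e" for P Q
    unfolding cnt_def by (rule sum_mono2) (use that in auto)
  have cnt_eq: "cnt P = cnt Q"
    if "\<And>e. P e \<Longrightarrow> Q e" "\<And>e. Q e \<Longrightarrow> Poly_Mapping.lookup m e \<noteq> 0 \<Longrightarrow> P e" for P Q
    unfolding cnt_def by (rule sum.mono_neutral_left) (use that in auto)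
  have cntN: "cnt (\<lambda>e. fst e < p) = cnt (\<lambda>_. True)" "cnt (\<lambda>e. snd e < p) = cnt (\<lambda>_. True)"
    unfolding cnt_def by (rule sum.cong; auto simp: psi_vars_def)+
  have D: "(\<Sum>v<i. vertex_degree p m v) = cnt (\<lambda>e. fst e < i) + cnt (\<lambda>e. snd e < i)" for i
    by (simp add: sum_vertex_degree_lessThan cnt_def)
  \<comment> \<open>For \<open>i = p\<close> both counts run over all edges, so the degree sum is
    twice the number of edges.\<close>
  have N: "N = cnt (\<lambda>_. True)"
    by (simp add: N_def D cntN)
  have A_le: "cnt (\<lambda>e. fst e < i) \<le> N" for i
    unfolding N by (rule cnt_mono) simp
  \<comment> \<open>A single first endpoint c >= i forces b >= c >= i for every second endpoint b.
    So second endpoints are counted only after all first endpoints have been.\<close>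
  have AB: "cnt (\<lambda>e. snd e < i) = 0 \<or> cnt (\<lambda>e. fst e < i) = N" for i
  proof (rule disjCI)
    assume "cnt (\<lambda>e. fst e < i) \<noteq> N"
    then obtain c d where cd: "Poly_Mapping.lookup m (c, d) \<noteq> 0" "\<not> c < i"
      using cnt_eq[of "\<lambda>e. fst e < i" "\<lambda>_. True"] unfolding N by force
    then have "Poly_Mapping.lookup m e = 0" if "snd e < i" for e
      using th(1)[of "fst e" "snd e" c d] that by force
    then show "cnt (\<lambda>e. snd e < i) = 0"
      by (simp add: cnt_def)
  qed
  \<comment> \<open>By this dichotomy the degree sum up to \<open>i\<close> fills the first
    endpoints up to \<open>N\<close>, and only the excess counts second endpoints; truncated
    subtraction supplies the 0 before that.\<close>
  have A: "cnt (\<lambda>e. fst e < i) = min (\<Sum>v<i. vertex_degree p m v) N" for i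
    using AB[of i] A_le[of i] unfolding D by auto
  have B: "cnt (\<lambda>e. snd e < i) = (\<Sum>v<i. vertex_degree p m v) - N" for i
    using AB[of i] A_le[of i] unfolding D by auto
  \<comment> \<open>If an edge (a, b) has a < i but b >= j, then every edge with second endpoint
    below j has first endpoint at most a, for otherwise it would be nested in (a, b). So one of the
    two conditions always implies the other.\<close>
  have "cnt (\<lambda>e. fst e < i \<and> snd e < j) = min (cnt (\<lambda>e. fst e < i)) (cnt (\<lambda>e. snd e < j))"
  proof (cases "\<exists>a b. Poly_Mapping.lookup m (a, b) \<noteq> 0 \<and> a < i \<and> \<not> b < j")
    case True
    then obtain a b where ab: "Poly_Mapping.lookup m (a, b) \<noteq> 0" "a < i" "\<not> b < j" by blast
    have "cnt (\<lambda>e. fst e < i \<and> snd e < j) = cnt (\<lambda>e. snd e < j)"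
    proof (rule cnt_eq)
      fix e assume "snd e < j" "Poly_Mapping.lookup m e \<noteq> 0"
      then show "fst e < i \<and> snd e < j"
        using th(2)[of a b "fst e" "snd e"] ab by force
    qed simp
    moreover have "cnt (\<lambda>e. fst e < i \<and> snd e < j) \<le> cnt (\<lambda>e. fst e < i)"
      by (rule cnt_mono) simp
    ultimately show ?thesis by simp
  next
    case False
    then have "cnt (\<lambda>e. fst e < i \<and> snd e < j) = cnt (\<lambda>e. fst e < i)"
      by (intro cnt_eq) (auto simp: split_paired_all, metis less_not_refl)
    moreover have "cnt (\<lambda>e. fst e < i \<and> snd e < j) \<le> cnt (\<lambda>e. snd e < j)"
      by (rule cnt_mono) simp
    ultimately show ?thesis by simp
  qed
  moreover have "(\<Sum>a<i. \<Sum>b<j. Poly_Mapping.lookup m (a, b)) = cnt (\<lambda>e. fst e < i \<and> snd e < j)"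
    unfolding cnt_def sum.cartesian_product
    by (intro sum.mono_neutral_cong_right) (auto, use keys in force)
  ultimately show ?thesis by (simp add: A B)
qed

text \<open>The degrees fix all rectangle sums, and inclusion-exclusion over four of them isolates a
  single multiplicity.\<close>

lemma thrackle_unique:
  assumes "m \<in> monomials (psi_vars p)" "thrackle m" "n \<in> monomials (psi_vars p)" "thrackle n"
    and "vertex_degree p m = vertex_degree p n"
  shows "m = n"
proof (rule poly_mapping_eqI)
  have R: "(\<Sum>a<i. \<Sum>b<j. Poly_Mapping.lookup m (a, b)) =
      (\<Sum>a<i. \<Sum>b<j. Poly_Mapping.lookup n (a, b))" for i j
    using assms by (simp add: thrackle_rectangle_sum)
  fix e :: "nat \<times> nat"
  obtain i j where e: "e = (i, j)" by fastforce
  show "Poly_Mapping.lookup m e = Poly_Mapping.lookup n e"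
    using R[where i = "Suc i" and j = "Suc j"] R[where i = "Suc i" and j = j]
      R[where i = i and j = "Suc j"] R[where i = i and j = j]
    unfolding e sum.lessThan_Suc sum.distrib by linarith
qed

text \<open>An edge cannot be used more often than the degree of its first endpoint. Finiteness
  provides a smallest monomial in each fiber.\<close>

lemma finite_vertex_degree_fiber:
  "finite {n \<in> monomials (psi_vars p). vertex_degree p n = d}" (is "finite ?S")
proof (rule finite_imageD)
  have "Poly_Mapping.lookup n e \<le> d (fst e)" if "n \<in> ?S" "e \<in> psi_vars p" for n e
  proof -
    have "Poly_Mapping.lookup n e \<le>
        Poly_Mapping.lookup n e * (of_bool (fst e = fst e) + of_bool (snd e = fst e))"
      by simp
    also have "\<dots> \<le> vertex_degree p n (fst e)"
      unfolding vertex_degree_def using that(2) by (intro member_le_sum) auto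
    finally show ?thesis using that(1) by simp
  qed
  then have "(\<lambda>n. restrict (Poly_Mapping.lookup n) (psi_vars p)) ` ?S \<subseteq>
      PiE (psi_vars p) (\<lambda>e. {..d (fst e)})"
    by (auto simp: PiE_def)
  then show "finite ((\<lambda>n. restrict (Poly_Mapping.lookup n) (psi_vars p)) ` ?S)"
    by (rule finite_subset) (intro finite_PiE; simp)
  show "inj_on (\<lambda>n. restrict (Poly_Mapping.lookup n) (psi_vars p)) ?S"
  proof (intro inj_onI poly_mapping_eqI)
    fix m n e
    assume "m \<in> ?S" "n \<in> ?S"
      and eq: "restrict (Poly_Mapping.lookup m) (psi_vars p) =
        restrict (Poly_Mapping.lookup n) (psi_vars p)"
    then have "Poly_Mapping.lookup m e = 0 \<and> Poly_Mapping.lookup n e = 0" if "e \<notin> psi_vars p"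
      using that unfolding monomials_def in_keys_iff[symmetric] not_in_keys_iff_lookup_eq_zero[symmetric]
      by blast
    then show "Poly_Mapping.lookup m e = Poly_Mapping.lookup n e"
      using fun_cong[OF eq, of e] by (cases "e \<in> psi_vars p") auto
  qed
qed

section \<open>The ideal of the one-factor model\<close>

lemma poly_eval_superset:
  assumes "finite V" and "f \<in> carrier (poly_ring V)"
  shows "poly_eval a f = (\<Sum>m\<in>Poly_Mapping.keys f. Poly_Mapping.lookup f m *
    (\<Prod>x\<in>V. a x ^ Poly_Mapping.lookup m x))"
  unfolding poly_eval_def
proof (intro sum.cong refl arg_cong2[of _ _ _ _ "(*)"] prod.mono_neutral_left)
  fix m assume "m \<in> Poly_Mapping.keys f"
  then show "Poly_Mapping.keys m \<subseteq> V"
    using assms(2) by (auto simp: poly_ring_def monomials_def)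
qed (use assms(1) in \<open>auto simp: in_keys_iff\<close>)

lemma one_factor_space_offdiagonal:
  assumes "\<Psi> \<in> one_factor_space p"
  obtains x where "\<And>i j. (i, j) \<in> psi_vars p \<Longrightarrow> \<Psi> $$ (i, j) = x i * x j"
proof -
  obtain \<Sigma> l where \<Psi>: "\<Psi> = \<Sigma> + mat_of_cols p [l] * transpose_mat (mat_of_cols p [l])"
    and \<Sigma>: "\<Sigma> \<in> carrier_mat p p" "diagonal_mat \<Sigma>" and l: "l \<in> carrier_vec p"
    using assms unfolding one_factor_space_def by blast
  show ?thesis
  proof (rule that[of "\<lambda>i. l $ i"])
    fix i j assume "(i, j) \<in> psi_vars p"
    then show "\<Psi> $$ (i, j) = l $ i * l $ j"
      using \<Sigma> l by (auto simp: \<Psi> psi_vars_def diagonal_mat_def scalar_prod_def mat_of_cols_def)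
  qed
qed

lemma one_factor_space_rank_one:
  obtains \<Psi> where "\<Psi> \<in> one_factor_space p"
    and "\<And>i j. (i, j) \<in> psi_vars p \<Longrightarrow> \<Psi> $$ (i, j) = x i * x j"
proof -
  define \<Psi> where "\<Psi> = 1\<^sub>m p + mat_of_cols p [vec p x] * transpose_mat (mat_of_cols p [vec p x])"
  have "positive_definite (1\<^sub>m p)"
    unfolding positive_definite_def
  proof (intro conjI ballI impI)
    fix v :: "real vec" assume v: "v \<in> carrier_vec (dim_row (1\<^sub>m p))" "v \<noteq> 0\<^sub>v (dim_row (1\<^sub>m p))"
    then obtain i where i: "i < p" "v $ i \<noteq> 0"
      by (auto simp: vec_eq_iff)
    have "0 < (\<Sum>i<p. (v $ i)\<^sup>2)"
      by (rule sum_pos2[of _ i]) (use i in auto)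
    then show "v \<bullet> (1\<^sub>m p *\<^sub>v v) > 0"
      using v by (simp add: scalar_prod_def power2_eq_square lessThan_atLeast0)
  qed (auto simp: transpose_mat_def)
  then have "\<Psi> \<in> one_factor_space p"
    unfolding \<Psi>_def one_factor_space_def
    by (intro CollectI exI[of _ "1\<^sub>m p"] exI[of _ "vec p x"]) (auto simp: diagonal_mat_def)
  moreover have "\<Psi> $$ (i, j) = x i * x j" if "(i, j) \<in> psi_vars p" for i j
    using that by (auto simp: \<Psi>_def psi_vars_def scalar_prod_def mat_of_cols_def)
  ultimately show ?thesis by (rule that)
qed

lemma prod_edges_eq_prod_vertices:
  fixes x :: "nat \<Rightarrow> real"
  shows "(\<Prod>e\<in>psi_vars p. (x (fst e) * x (snd e)) ^ Poly_Mapping.lookup m e) =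
    (\<Prod>v<p. x v ^ vertex_degree p m v)"
proof -
  have "(\<Prod>v<p. x v ^ vertex_degree p m v) = (\<Prod>v<p. \<Prod>e\<in>psi_vars p.
      (x v ^ (of_bool (fst e = v) + of_bool (snd e = v))) ^ Poly_Mapping.lookup m e)"
    by (simp add: vertex_degree_def power_sum flip: power_mult) (simp add: mult.commute)
  also have "\<dots> = (\<Prod>e\<in>psi_vars p.
      (\<Prod>v<p. x v ^ (of_bool (fst e = v) + of_bool (snd e = v))) ^ Poly_Mapping.lookup m e)"
    by (subst prod.swap) (simp add: prod_power_distrib)
  also have "\<dots> = (\<Prod>e\<in>psi_vars p. (x (fst e) * x (snd e)) ^ Poly_Mapping.lookup m e)"
  proof (intro prod.cong refl arg_cong2[of _ _ _ _ power])
    fix e assume "e \<in> psi_vars p"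
    \<comment> \<open>In conditional form the product over all vertices collapses to the factors at
      the two endpoints, both of which lie below \<open>p\<close>.\<close>
    moreover have "x v ^ of_bool (a = v) = (if v = a then x v else 1)" for a v
      by simp
    ultimately show "(\<Prod>v<p. x v ^ (of_bool (fst e = v) + of_bool (snd e = v))) = x (fst e) * x (snd e)"
      by (auto simp: power_add prod.distrib prod.delta psi_vars_def)
  qed
  finally show ?thesis by simp
qed

text \<open>Off the diagonal the model takes exactly the values x_i x_j: the diagonal summand drops
  out, and the identity matrix as diagonal part realizes every x.\<close>

lemma one_factor_ideal_iff:
  "f \<in> one_factor_ideal p \<longleftrightarrow> f \<in> carrier (poly_ring (psi_vars p)) \<and>
    (\<forall>x. (\<Sum>m\<in>Poly_Mapping.keys f. Poly_Mapping.lookup f m * (\<Prod>v<p. x v ^ vertex_degree p m v)) = 0)"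
proof -
  have eval: "poly_eval (\<lambda>(i, j). \<Psi> $$ (i, j)) f =
      (\<Sum>m\<in>Poly_Mapping.keys f. Poly_Mapping.lookup f m * (\<Prod>v<p. x v ^ vertex_degree p m v))"
    if "f \<in> carrier (poly_ring (psi_vars p))"
      and "\<And>i j. (i, j) \<in> psi_vars p \<Longrightarrow> \<Psi> $$ (i, j) = x i * x j" for \<Psi> and x :: "nat \<Rightarrow> real"
    unfolding poly_eval_superset[OF finite_psi_vars that(1)]
    unfolding prod_edges_eq_prod_vertices[symmetric]
    by (intro sum.cong refl arg_cong2[of _ _ _ _ "(*)"] prod.cong) (use that(2) in auto)
  show ?thesis
    unfolding one_factor_ideal_def mem_Collect_eq
  proof (intro conj_cong refl iffI allI ballI)
    fix x :: "nat \<Rightarrow> real"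
    assume f: "f \<in> carrier (poly_ring (psi_vars p))"
      and 0: "\<forall>\<Psi>\<in>one_factor_space p. poly_eval (\<lambda>(i, j). \<Psi> $$ (i, j)) f = 0"
    obtain \<Psi> where "\<Psi> \<in> one_factor_space p"
      and "\<And>i j. (i, j) \<in> psi_vars p \<Longrightarrow> \<Psi> $$ (i, j) = x i * x j"
      using one_factor_space_rank_one[of p x] by metis
    then show "(\<Sum>m\<in>Poly_Mapping.keys f.
        Poly_Mapping.lookup f m * (\<Prod>v<p. x v ^ vertex_degree p m v)) = 0"
      using eval[OF f, of \<Psi> x] 0 by simp
  next
    fix \<Psi>
    assume f: "f \<in> carrier (poly_ring (psi_vars p))"
      and 0: "\<forall>x. (\<Sum>m\<in>Poly_Mapping.keys f.
        Poly_Mapping.lookup f m * (\<Prod>v<p. x v ^ vertex_degree p m v)) = 0"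
      and \<Psi>: "\<Psi> \<in> one_factor_space p"
    obtain x where "\<And>i j. (i, j) \<in> psi_vars p \<Longrightarrow> \<Psi> $$ (i, j) = x i * x j"
      using one_factor_space_offdiagonal[OF \<Psi>] by metis
    then show "poly_eval (\<lambda>(i, j). \<Psi> $$ (i, j)) f = 0"
      using eval[OF f, of \<Psi> x] 0 by simp
  qed
qed

text \<open>A real polynomial function that vanishes identically has zero coefficients; here several
  indices may share an exponent vector, so a coefficient is a fiber sum. The induction splits off
  one variable at a time.\<close>

lemma sum_monomials_zero_imp_fiber_sum_zero:
  fixes c :: "'a \<Rightarrow> real" and g :: "'a \<Rightarrow> nat \<Rightarrow> nat"
  assumes "finite S" and "\<And>x. (\<Sum>s\<in>S. c s * (\<Prod>v<n. x v ^ g s v)) = 0"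
  shows "sum c {s\<in>S. \<forall>v<n. g s v = d v} = 0"
  using assms
proof (induction n arbitrary: S)
  case 0
  then show ?case by simp
next
  case (Suc n)
  have "(\<Sum>s\<in>{s\<in>S. g s n = d n}. c s * (\<Prod>v<n. x v ^ g s v)) = 0" for x
  proof -
    \<comment> \<open>With the other variables frozen, the sum is a univariate polynomial in the
      last one. It vanishes at every real number, hence so does its coefficient of degree
      \<open>d n\<close>.\<close>
    define P where "P = (\<Sum>s\<in>S. monom (c s * (\<Prod>v<n. x v ^ g s v)) (g s n))"
    have "poly P t = 0" for t
    proof -
      have "poly P t = (\<Sum>s\<in>S. c s * (\<Prod>v<Suc n. (x(n := t)) v ^ g s v))"
        by (auto simp: P_def poly_sum poly_monom mult.assoc intro!: sum.cong prod.cong)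
      then show ?thesis by (simp only: Suc.prems(2))
    qed
    then have "P = 0"
      using poly_all_0_iff_0 by blast
    then have "coeff P (d n) = 0" by simp
    then show ?thesis
      using Suc.prems(1) by (simp add: P_def coeff_sum sum.inter_filter cong: if_cong)
  qed
  then have "sum c {s\<in>{s\<in>S. g s n = d n}. \<forall>v<n. g s v = d v} = 0"
    using Suc.prems(1) by (intro Suc.IH) auto
  also have "{s\<in>{s\<in>S. g s n = d n}. \<forall>v<n. g s v = d v} = {s\<in>S. \<forall>v<Suc n. g s v = d v}"
    by (auto simp: less_Suc_eq)
  finally show ?case .
qed

text \<open>If \<open>m\<close> were alone in its fiber, the vanishing fiber sum would be its own
  nonzero coefficient.\<close>

lemma one_factor_ideal_degree_partner:
  assumes f: "f \<in> one_factor_ideal p" and m: "m \<in> Poly_Mapping.keys f"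
  obtains n where "n \<in> Poly_Mapping.keys f" "n \<noteq> m" "vertex_degree p n = vertex_degree p m"
proof (rule ccontr)
  assume "\<not> thesis"
  then have "{n \<in> Poly_Mapping.keys f. vertex_degree p n = vertex_degree p m} = {m}"
    using m that by auto
  \<comment> \<open>Degrees vanish from \<open>p\<close> on, so agreement below \<open>p\<close> is
    equality of functions.\<close>
  moreover have "vertex_degree p n = vertex_degree p m \<longleftrightarrow>
      (\<forall>v<p. vertex_degree p n v = vertex_degree p m v)" for n
    by (metis ext linorder_not_le vertex_degree_eq_0)
  ultimately have "sum (Poly_Mapping.lookup f) {m} = 0"
    using sum_monomials_zero_imp_fiber_sum_zero[of "Poly_Mapping.keys f" "Poly_Mapping.lookup f"
        "vertex_degree p" p "vertex_degree p m"] f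
    by (simp add: one_factor_ideal_iff)
  then show False using m by (simp add: in_keys_iff)
qed

text \<open>A nonzero element would contain two different thrackles with equal vertex
  degrees.\<close>

lemma one_factor_ideal_eq_zero_if_thrackles:
  assumes "\<And>m. m \<in> monomials (psi_vars p) \<Longrightarrow> thrackle m"
  shows "one_factor_ideal p = {0}"
proof -
  have "f = 0" if f: "f \<in> one_factor_ideal p" for f
  proof (rule ccontr)
    assume "f \<noteq> 0"
    then obtain m where m: "m \<in> Poly_Mapping.keys f" by fastforce
    obtain n where n: "n \<in> Poly_Mapping.keys f" "n \<noteq> m" "vertex_degree p n = vertex_degree p m"
      using one_factor_ideal_degree_partner[OF f m] .
    have "m \<in> monomials (psi_vars p)" "n \<in> monomials (psi_vars p)"
      using f m n(1) by (auto simp: one_factor_ideal_def poly_ring_def)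
    then show False
      using thrackle_unique[of m p n] n assms by metis
  qed
  moreover have "0 \<in> one_factor_ideal p"
    by (simp add: one_factor_ideal_iff poly_ring_def)
  ultimately show ?thesis by blast
qed

text \<open>Any two edges on at most three vertices share a vertex, whereas an underlined term
  involves four.\<close>

lemma thrackle_if_le_3:
  assumes "p \<le> 3" and "m \<in> monomials (psi_vars p)"
  shows "thrackle m"
proof -
  have key: "a < b \<and> b < 3" if "(a, b) \<in> Poly_Mapping.keys m" for a b
    using assms that by (force simp: monomials_def psi_vars_def)
  have "c \<le> b \<and> \<not> (a < c \<and> d < b)"
    if "(a, b) \<in> Poly_Mapping.keys m" "(c, d) \<in> Poly_Mapping.keys m" for a b c d
    using that[THEN key] by linarith
  then show ?thesis unfolding thrackle_def by blast
qed

section \<open>Monomial orders\<close>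

text \<open>Serves for leading monomials as well as for smallest monomials of fibers; both sets are
  finite, so linearity of the order suffices.\<close>

lemma linear_order_on_finite_minimum:
  assumes "linear_order_on A r" "finite K" "K \<noteq> {}" "K \<subseteq> A"
  obtains m where "m \<in> K" "\<And>n. n \<in> K \<Longrightarrow> (m, n) \<in> r"
proof -
  have tot: "\<And>a b. a \<in> A \<Longrightarrow> b \<in> A \<Longrightarrow> (a, b) \<in> r \<or> (b, a) \<in> r" and trans: "trans r"
    using assms(1) unfolding order_on_defs total_on_def refl_on_def by metis+
  have "\<exists>m\<in>K. \<forall>n\<in>K. (m, n) \<in> r"
    using assms(2-4)
  proof (induction K rule: finite_ne_induct)
    case (singleton a)
    then show ?case using tot[of a a] by auto
  next
    case (insert a K)
    then obtain m where m: "m \<in> K" "\<forall>n\<in>K. (m, n) \<in> r" by auto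
    show ?case
    proof (cases "(m, a) \<in> r")
      case True
      then show ?thesis using m by auto
    next
      case False
      then have "(a, m) \<in> r" using tot[of a m] m insert.prems by auto
      then have "\<forall>n\<in>insert a K. (a, n) \<in> r"
        using m tot[of a a] insert.prems transD[OF trans] by blast
      then show ?thesis by blast
    qed
  qed
  then show ?thesis using that by blast
qed

lemma lead_monomial_properties:
  assumes r: "monomial_order V r" and f: "f \<in> carrier (poly_ring V)" "f \<noteq> 0"
  shows "lead_monomial r f \<in> Poly_Mapping.keys f"
    and "\<And>m. m \<in> Poly_Mapping.keys f \<Longrightarrow> (m, lead_monomial r f) \<in> r"
proof -
  have lin: "linear_order_on (monomials V) r"
    using r by (simp add: monomial_order_def)
  then have anti: "antisym r" by (simp add: order_on_defs)
  \<comment> \<open>The leading monomial is a minimum for the converse order.\<close>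
  have "linear_order_on (monomials V) (r\<inverse>)" using lin by simp
  then obtain m where m: "m \<in> Poly_Mapping.keys f" "\<And>n. n \<in> Poly_Mapping.keys f \<Longrightarrow> (n, m) \<in> r"
    by (rule linear_order_on_finite_minimum[where K = "Poly_Mapping.keys f"])
       (use f in \<open>auto simp: poly_ring_def\<close>)
  have "lead_monomial r f = m"
    unfolding lead_monomial_def
    by (rule the_equality) (use m antisymD[OF anti] in blast)+
  then show "lead_monomial r f \<in> Poly_Mapping.keys f"
    and "\<And>m. m \<in> Poly_Mapping.keys f \<Longrightarrow> (m, lead_monomial r f) \<in> r"
    using m by auto
qed

lemma lead_term_in_carrier:
  assumes "monomial_order V r" "f \<in> carrier (poly_ring V)" "f \<noteq> 0"
  shows "lead_term r f \<in> carrier (poly_ring V)"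
  using lead_monomial_properties(1)[OF assms] assms(2)
  by (auto simp: lead_term_def poly_ring_def)

section \<open>Tetrads\<close>

definition edge_pair :: "nat \<times> nat \<Rightarrow> nat \<times> nat \<Rightarrow> (nat \<times> nat) monomial" where
  "edge_pair u v = Poly_Mapping.single u 1 + Poly_Mapping.single v 1"

lemma keys_edge_pair [simp]: "Poly_Mapping.keys (edge_pair u v) = {u, v}"
  by (auto simp: edge_pair_def in_keys_iff lookup_add lookup_single when_def split: if_splits)

lemma psi_mult_psi: "psi i j * psi k l = Poly_Mapping.single (edge_pair (i, j) (k, l)) 1"
  by (simp add: psi_def edge_pair_def mult_single)

lemma edge_pair_dvd:
  assumes "u \<noteq> v" "u \<in> Poly_Mapping.keys m" "v \<in> Poly_Mapping.keys m"
  shows "\<exists>c. m = edge_pair u v + c"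
proof
  \<comment> \<open>The truncated difference is a true quotient: \<open>u\<close> and
    \<open>v\<close> are distinct, and each has exponent at least one in \<open>m\<close>.\<close>
  show "m = edge_pair u v + (m - edge_pair u v)"
    using assms
    by (intro poly_mapping_eqI)
       (auto simp: edge_pair_def lookup_add lookup_minus lookup_single when_def in_keys_iff)
qed

text \<open>Brings both kinds of tetrads into one shape, an underlined monomial \<open>a\<close>
  minus the monomial of the crossing edges, so that later arguments treat them together.\<close>

lemma tetradE:
  assumes "t \<in> tetrads p"
  obtains i j k l a where "i < j" "j < k" "k < l" "l < p"
    and "a = edge_pair (i, j) (k, l) \<or> a = edge_pair (i, l) (j, k)"
    and "t = Poly_Mapping.single a 1 - Poly_Mapping.single (edge_pair (i, k) (j, l)) 1"
    and "\<And>r. selects_underlined_terms p r \<Longrightarrow> lead_term r t = Poly_Mapping.single a 1"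
proof -
  obtain i j k l where 1: "i < j" "j < k" "k < l" "l < p"
    and "t = tetrad1 i j k l \<or> t = tetrad2 i j k l"
    using assms unfolding tetrads_def by blast
  then consider "t = tetrad1 i j k l" | "t = tetrad2 i j k l" by blast
  then show ?thesis
  proof cases
    case 1
    with \<open>i < j\<close> \<open>j < k\<close> \<open>k < l\<close> \<open>l < p\<close> show ?thesis
      by (intro that[of i j k l "edge_pair (i, j) (k, l)"])
         (auto simp: selects_underlined_terms_def psi_mult_psi tetrad1_def)
  next
    case 2
    with \<open>i < j\<close> \<open>j < k\<close> \<open>k < l\<close> \<open>l < p\<close> show ?thesis
      by (intro that[of i j k l "edge_pair (i, l) (j, k)"])
         (auto simp: selects_underlined_terms_def psi_mult_psi tetrad2_def)
  qed
qed

lemma lead_term_eq_single_1: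
  assumes "lead_term r t = Poly_Mapping.single a 1"
  shows "lead_monomial r t = a" and "leading_coefficient r t = 1"
proof -
  have "Poly_Mapping.lookup (lead_term r t) a = 1" by (simp add: assms)
  then show "lead_monomial r t = a" and "leading_coefficient r t = 1"
    by (auto simp: lead_term_def lookup_single when_def split: if_splits)
qed

lemma leading_coefficient_tetrad:
  assumes "selects_underlined_terms p r" "t \<in> tetrads p"
  shows "leading_coefficient r t = 1"
  using tetradE[OF assms(2)] lead_term_eq_single_1(2) assms(1) by metis

text \<open>Both monomials meet each of the vertices i, j, k, l exactly once, so their values at
  psi_ij = x_i x_j cancel.\<close>

lemma tetrad_in_one_factor_ideal:
  assumes "t \<in> tetrads p"
  shows "t \<in> one_factor_ideal p"
proof -
  obtain i j k l a where 1: "i < j" "j < k" "k < l" "l < p"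
    and a: "a = edge_pair (i, j) (k, l) \<or> a = edge_pair (i, l) (j, k)"
    and t': "t = Poly_Mapping.single a 1 - Poly_Mapping.single (edge_pair (i, k) (j, l)) 1"
    using tetradE[OF assms] by metis
  define b where "b = edge_pair (i, k) (j, l)"
  have t: "t = Poly_Mapping.single a 1 - Poly_Mapping.single b 1" by (simp add: t' b_def)
  have vars: "{(i, j), (k, l), (i, k), (j, l), (i, l), (j, k)} \<subseteq> psi_vars p"
    using 1 by (auto simp: psi_vars_def)
  have "Poly_Mapping.keys a \<noteq> Poly_Mapping.keys b"
    using a 1 by (auto simp: b_def doubleton_eq_iff)
  then have ab: "a \<noteq> b" by auto
  then have keys: "Poly_Mapping.keys t = {a, b}"
    by (auto simp: t in_keys_iff lookup_minus lookup_single when_def split: if_splits)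
  have "vertex_degree p a = vertex_degree p b"
    using a vars
    by (auto simp: b_def edge_pair_def vertex_degree_add vertex_degree_single fun_eq_iff
        simp del: One_nat_def)
  then have "(\<Sum>m\<in>Poly_Mapping.keys t.
      Poly_Mapping.lookup t m * (\<Prod>v<p. x v ^ vertex_degree p m v)) = 0" for x
    unfolding keys using ab by (simp add: t lookup_minus lookup_single)
  moreover have "t \<in> carrier (poly_ring (psi_vars p))"
    using a vars by (auto simp: poly_ring_def keys monomials_def b_def)
  ultimately show ?thesis by (simp add: one_factor_ideal_iff)
qed

lemma finite_tetrads: "finite (tetrads p)"
proof -
  let ?f = "\<lambda>(i, j, k, l). {tetrad1 i j k l, tetrad2 i j k l}"
  have "tetrads p \<subseteq> (\<Union>x\<in>{..<p} \<times> {..<p} \<times> {..<p} \<times> {..<p}. ?f x)"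
    by (fastforce simp: tetrads_def)
  then show ?thesis
    by (rule finite_subset) (auto intro!: finite_UN_I)
qed

lemma tetrad_nonzero:
  assumes "selects_underlined_terms p r" "t \<in> tetrads p"
  shows "t \<noteq> 0"
  using leading_coefficient_tetrad[OF assms] by (auto simp: leading_coefficient_def)

text \<open>An offending pair of edges is itself an underlined term: of the first kind if one edge
  ends before the other begins, of the second kind if the edges are nested.\<close>

lemma nonthrackle_divisible:
  assumes sel: "selects_underlined_terms p r" and m: "m \<in> monomials (psi_vars p)" "\<not> thrackle m"
  obtains t c where "t \<in> tetrads p" "m = lead_monomial r t + c"
proof -
  obtain u v where uv: "u \<in> Poly_Mapping.keys m" "v \<in> Poly_Mapping.keys m"
    "snd u < fst v \<or> fst u < fst v \<and> snd v < snd u"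
    using m(2) by (force simp: thrackle_def not_le)
  have *: "fst u < snd u" "snd u < p" "fst v < snd v" "snd v < p"
    using uv m(1) by (force simp: monomials_def psi_vars_def)+
  have "\<exists>t\<in>tetrads p. lead_term r t = Poly_Mapping.single (edge_pair u v) 1"
    using uv(3)
  proof
    assume "snd u < fst v"
    then show ?thesis
      using * sel
      by (intro bexI[of _ "tetrad1 (fst u) (snd u) (fst v) (snd v)"])
         (auto simp: selects_underlined_terms_def tetrads_def psi_mult_psi)
  next
    assume "fst u < fst v \<and> snd v < snd u"
    then show ?thesis
      using * sel
      by (intro bexI[of _ "tetrad2 (fst u) (fst v) (snd v) (snd u)"])
         (auto simp: selects_underlined_terms_def tetrads_def psi_mult_psi)
  qed
  then obtain t where t: "t \<in> tetrads p" "lead_term r t = Poly_Mapping.single (edge_pair u v) 1"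
    by blast
  have "lead_monomial r t = edge_pair u v"
    using lead_term_eq_single_1(1)[OF t(2)] .
  moreover have "u \<noteq> v" using uv(3) * by auto
  ultimately show ?thesis
    using edge_pair_dvd[OF _ uv(1,2)] t(1) that by metis
qed

text \<open>Every nonzero element of the ideal contains, besides its leading monomial, a smaller monomial
  with the same vertex degrees. For a tetrad this shows that the smallest monomial with given
  vertex degrees is a thrackle; in general it shows that a leading monomial is never the smallest.\<close>

lemma lead_monomial_not_thrackle:
  assumes r: "monomial_order (psi_vars p) r" and sel: "selects_underlined_terms p r"
    and f: "f \<in> one_factor_ideal p" "f \<noteq> 0"
  shows "\<not> thrackle (lead_monomial r f)"
proof
  let ?V = "psi_vars p"
  let ?m = "lead_monomial r f"
  assume thr: "thrackle ?m"
  have anti: "antisym r" and lin: "linear_order_on (monomials ?V) r"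
    using r by (auto simp: monomial_order_def order_on_defs)
  have carrier: "one_factor_ideal p \<subseteq> carrier (poly_ring ?V)"
    by (auto simp: one_factor_ideal_def)
  have partner: "\<exists>n\<in>monomials ?V. (n, lead_monomial r g) \<in> r \<and> n \<noteq> lead_monomial r g \<and>
      vertex_degree p n = vertex_degree p (lead_monomial r g) \<and> lead_monomial r g \<in> monomials ?V"
    if g: "g \<in> one_factor_ideal p" "g \<noteq> 0" for g
  proof -
    have c: "g \<in> carrier (poly_ring ?V)" using g carrier by blast
    note lm = lead_monomial_properties[OF r c g(2)]
    obtain n where "n \<in> Poly_Mapping.keys g" "n \<noteq> lead_monomial r g"
      "vertex_degree p n = vertex_degree p (lead_monomial r g)"
      using one_factor_ideal_degree_partner[OF g(1) lm(1)] .
    then show ?thesis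
      using lm c by (intro bexI[of _ n]) (auto simp: poly_ring_def)
  qed
  obtain n where n: "n \<in> monomials ?V" "(n, ?m) \<in> r" "n \<noteq> ?m" "vertex_degree p n = vertex_degree p ?m"
    and m: "?m \<in> monomials ?V"
    using partner[OF f] by blast
  let ?S = "{n \<in> monomials ?V. vertex_degree p n = vertex_degree p ?m}"
  obtain s where s: "s \<in> ?S" and min: "\<And>n. n \<in> ?S \<Longrightarrow> (s, n) \<in> r"
    by (rule linear_order_on_finite_minimum[OF lin finite_vertex_degree_fiber, of p "vertex_degree p ?m"])
       (use m in auto)
  \<comment> \<open>Otherwise an underlined term divides \<open>s\<close>. Trading it for the other
    monomial of its tetrad stays in the fiber and goes strictly down, against minimality.\<close>
  have "thrackle s"
  proof (rule ccontr)
    assume "\<not> thrackle s"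
    then obtain t c where t: "t \<in> tetrads p" and c: "s = lead_monomial r t + c"
      using nonthrackle_divisible[OF sel, of s] s by auto
    obtain b where b: "b \<in> monomials ?V" "(b, lead_monomial r t) \<in> r" "b \<noteq> lead_monomial r t"
      "vertex_degree p b = vertex_degree p (lead_monomial r t)" "lead_monomial r t \<in> monomials ?V"
      using partner[OF tetrad_in_one_factor_ideal[OF t] tetrad_nonzero[OF sel t]] by blast
    have cV: "c \<in> monomials ?V"
      using s by (auto simp: c monomials_def in_keys_iff lookup_add)
    have "(b + c, s) \<in> r"
      using r b cV by (auto simp: monomial_order_def c)
    moreover have "b + c \<in> ?S"
      using s b(1) cV Poly_Mapping.keys_add[of b c]
      by (auto simp: monomials_def c vertex_degree_add b(4) fun_eq_iff)
    ultimately have "b + c = s"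
      using min antisymD[OF anti] by blast
    then show False using b(3) by (simp add: c)
  qed
  \<comment> \<open>Two thrackles in one fiber coincide, so the leading monomial is the fiber
    minimum; but \<open>n\<close> lies strictly below it.\<close>
  then have "s = ?m"
    using thrackle_unique thr s m by auto
  then have "n = ?m"
    using min[of n] n antisymD[OF anti] by blast
  with n(3) show False by simp
qed

section \<open>From leading monomials to ideals: Groebner basis and reducedness\<close>

lemma lead_term_in_tetrad_ideal:
  assumes r: "monomial_order (psi_vars p) r" and sel: "selects_underlined_terms p r"
    and f: "f \<in> one_factor_ideal p" "f \<noteq> 0"
  shows "lead_term r f \<in> Idl\<^bsub>poly_ring (psi_vars p)\<^esub> (lead_term r ` tetrads p)"
proof -
  let ?R = "poly_ring (psi_vars p)"
  interpret cring ?R by (rule poly_ring_cring)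
  have fc: "f \<in> carrier ?R" using f by (simp add: one_factor_ideal_def)
  have m: "lead_monomial r f \<in> monomials (psi_vars p)"
    using lead_monomial_properties(1)[OF r fc f(2)] fc by (auto simp: poly_ring_def)
  obtain t c where t: "t \<in> tetrads p" and c: "lead_monomial r f = lead_monomial r t + c"
    using nonthrackle_divisible[OF sel m lead_monomial_not_thrackle[OF assms]] .
  have sub: "lead_term r ` tetrads p \<subseteq> carrier ?R"
    using lead_term_in_carrier[OF r] tetrad_in_one_factor_ideal tetrad_nonzero[OF sel]
    by (auto simp: one_factor_ideal_def)
  have lc: "leading_coefficient r t = 1"
    using leading_coefficient_tetrad[OF sel t] .
  \<comment> \<open>The cofactor carries the whole leading coefficient of \<open>f\<close>, since
    \<open>t\<close> is monic.\<close>
  let ?q = "Poly_Mapping.single c (leading_coefficient r f)"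
  have "c \<in> monomials (psi_vars p)"
    using m by (auto simp: c monomials_def in_keys_iff lookup_add)
  then have q: "?q \<in> carrier ?R" by (simp add: poly_ring_def)
  have "lead_term r t \<otimes>\<^bsub>?R\<^esub> ?q \<in> Idl\<^bsub>?R\<^esub> (lead_term r ` tetrads p)"
    using genideal_self[OF sub] t
    by (intro ideal.I_r_closed[OF genideal_ideal[OF sub]] q) auto
  also have "lead_term r t \<otimes>\<^bsub>?R\<^esub> ?q = lead_term r f"
    by (simp add: poly_ring_def lead_term_def lc c mult_single)
  finally show ?thesis .
qed

lemma tetrads_groebner_basis:
  assumes r: "monomial_order (psi_vars p) r" and sel: "selects_underlined_terms p r"
  shows "groebner_basis (psi_vars p) r (one_factor_ideal p) (tetrads p)"
proof -
  let ?R = "poly_ring (psi_vars p)"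
  let ?I = "one_factor_ideal p"
  interpret cring ?R by (rule poly_ring_cring)
  have nz: "0 \<notin> tetrads p" using tetrad_nonzero[OF sel] by blast
  have sub: "tetrads p \<subseteq> ?I" using tetrad_in_one_factor_ideal by blast
  have I: "lead_term r ` (?I - {0}) \<subseteq> carrier ?R"
    using lead_term_in_carrier[OF r] by (auto simp: one_factor_ideal_def)
  have T: "lead_term r ` tetrads p \<subseteq> lead_term r ` (?I - {0})"
    using sub nz by blast
  have "Idl\<^bsub>?R\<^esub> (lead_term r ` tetrads p) = Idl\<^bsub>?R\<^esub> (lead_term r ` (?I - {0}))"
  proof (rule equalityI)
    show "Idl\<^bsub>?R\<^esub> (lead_term r ` tetrads p) \<subseteq> Idl\<^bsub>?R\<^esub> (lead_term r ` (?I - {0}))"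
      using T genideal_self[OF I] by (intro genideal_minimal genideal_ideal I) blast
    show "Idl\<^bsub>?R\<^esub> (lead_term r ` (?I - {0})) \<subseteq> Idl\<^bsub>?R\<^esub> (lead_term r ` tetrads p)"
      using T I lead_term_in_tetrad_ideal[OF assms]
      by (intro genideal_minimal genideal_ideal) auto
  qed
  then show ?thesis
    using finite_tetrads sub nz by (simp add: groebner_basis_def initial_ideal_def)
qed

text \<open>All monomials in a tetrad are products of two distinct edges, so divisibility forces
  equal edge pairs. A crossing pair is never underlined, hence only leading monomials can match, and
  an underlined pair determines its tetrad.\<close>

lemma tetrads_reduced:
  assumes sel: "selects_underlined_terms p r"
    and g: "g \<in> tetrads p" and h: "h \<in> tetrads p"
    and m: "m \<in> Poly_Mapping.keys h" and dvd: "monomial_divides (lead_monomial r g) m"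
  shows "g = h"
proof -
  have sub: "Poly_Mapping.keys (lead_monomial r g) \<subseteq> Poly_Mapping.keys m"
    using dvd by (auto simp: monomial_divides_def in_keys_iff lookup_add)
  obtain i j k l a where 1: "i < j" "j < k" "k < l"
    and a: "a = edge_pair (i, j) (k, l) \<or> a = edge_pair (i, l) (j, k)"
    and gg: "g = Poly_Mapping.single a 1 - Poly_Mapping.single (edge_pair (i, k) (j, l)) 1"
    and lg: "lead_monomial r g = a"
    using tetradE[OF g] lead_term_eq_single_1(1) sel by metis
  obtain i' j' k' l' a' where 2: "i' < j'" "j' < k'" "k' < l'"
    and a': "a' = edge_pair (i', j') (k', l') \<or> a' = edge_pair (i', l') (j', k')"
    and hh: "h = Poly_Mapping.single a' 1 - Poly_Mapping.single (edge_pair (i', k') (j', l')) 1"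
    using tetradE[OF h] by metis
  have "m = a' \<or> m = edge_pair (i', k') (j', l')"
    using m by (auto simp: hh in_keys_iff lookup_minus lookup_single when_def split: if_splits)
  \<comment> \<open>The four indices are recovered as the sorted vertices of the common edge pair;
    the crossing alternative for \<open>m\<close> is contradictory.\<close>
  then have "i' = i \<and> j' = j \<and> k' = k \<and> l' = l \<and> Poly_Mapping.keys a = Poly_Mapping.keys a'"
    using a a' sub 1 2 unfolding lg by auto
  then have "i' = i" "j' = j" "k' = k" "l' = l" "a' = a"
    using a a' 1 by (auto simp: doubleton_eq_iff)
  then show ?thesis by (simp add: gg hh)
qed

theorem theorem16:
  fixes p :: nat
  assumes "p \<ge> 1"
  shows "(p \<le> 3 \<longrightarrow> one_factor_ideal p = {0}) \<and>
    (p \<ge> 4 \<longrightarrow>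
      (\<forall>r. monomial_order (psi_vars p) r \<and> selects_underlined_terms p r \<longrightarrow>
        reduced_groebner_basis (psi_vars p) r (one_factor_ideal p) (tetrads p)))"
proof (intro conjI allI impI)
  assume "p \<le> 3"
  then show "one_factor_ideal p = {0}"
    using one_factor_ideal_eq_zero_if_thrackles thrackle_if_le_3 by blast
next
  fix r assume "monomial_order (psi_vars p) r \<and> selects_underlined_terms p r"
  then have r: "monomial_order (psi_vars p) r" and sel: "selects_underlined_terms p r" by auto
  show "reduced_groebner_basis (psi_vars p) r (one_factor_ideal p) (tetrads p)"
    unfolding reduced_groebner_basis_def
    using tetrads_groebner_basis[OF r sel] tetrads_reduced[OF sel] leading_coefficient_tetrad[OF sel]
    by blast
qed

end
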